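(* Let $x=(x_1,\dots,x_n)^T,\ y=(y_1,\dots,y_n)^T\in\mathbb{R}_{\max}^n$. Then $x\prec_{\max}y$ (that is, $x$ is max-majorized by $y$) if and only if $$\max_{1\le i\le n}x_i=\max_{1\le i\le n}y_i\qquad\text{and}\qquad \min_{1\le i\le n}x_i\ge\min_{1\le i\le n}y_i .$$
   Context: Max algebra: $\mathbb{R}_{\max}$ denotes the semiring $(\mathbb{R}_{\ge 0},\oplus,\otimes)$ with $a\oplus b=\max(a,b)$ and $a\otimes b=ab$. $\mathbb{R}_{\max}^n$ is the set of column vectors of length $n$ with entries in $\mathbb{R}_{\ge0}$, and $M_n(\mathbb{R}_{\max})$ is the set of $n\times n$ matrices with entries in $\mathbb{R}_{\ge 0}$. The matrix product is $(A\otimes B)_{i,j}=\max_k a_{i,k}b_{k,j}$ (likewise for matrix-vector products). Let $\mathbf{1}=(1,\dots,1)^T\in\mathbb{R}_{\max}^n$. A matrix $D\in M_n(\mathbb{R}_{\max})$ is max-doubly stochastic if $D\otimes\mathbf{1}=\mathbf{1}$ and $\mathbf{1}^T\otimes D=\mathbf{1}^T$. For $x,y\in\mathbb{R}_{\max}^n$, $x$ is max-majorized by $y$, written $x\prec_{\max}y$, if there is a max-doubly stochastic matrix $D$ with $x=D\otimes y$. *)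

theory Defs
  imports "HOL-Analysis.Analysis"
begin

text \<open>
  The max-times semiring is represented by the nonnegative reals inside \<^typ>\<open>real\<close>;
  vectors and matrices over it are real vectors and matrices with nonnegative entries.
\<close>

definition Rmax :: "real set" where
  "Rmax = {0..}"

definition Rmax_vecs :: "(real ^ 'n) set" where
  "Rmax_vecs = {x. \<forall>i. x $ i \<in> Rmax}"

definition Rmax_mats :: "(real ^ 'n ^ 'm) set" where
  "Rmax_mats = {A. \<forall>i j. A $ i $ j \<in> Rmax}"

definition max_mult_vec :: "real ^ 'n ^ 'm \<Rightarrow> real ^ 'n \<Rightarrow> real ^ 'm" where
  "max_mult_vec A x = (\<chi> i. MAX k. A $ i $ k * x $ k)"

definition max_vec_mult :: "real ^ 'm \<Rightarrow> real ^ 'n ^ 'm \<Rightarrow> real ^ 'n" where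
  "max_vec_mult x A = (\<chi> j. MAX k. x $ k * A $ k $ j)"

text \<open>Below, \<open>1 :: real ^ 'n\<close> is the all-ones vector.\<close>

definition max_doubly_stochastic :: "real ^ 'n ^ 'n \<Rightarrow> bool" where
  "max_doubly_stochastic D \<longleftrightarrow>
     D \<in> Rmax_mats \<and> max_mult_vec D 1 = 1 \<and> max_vec_mult 1 D = 1"

definition max_majorized :: "real ^ 'n \<Rightarrow> real ^ 'n \<Rightarrow> bool"  (infix "\<prec>\<^sub>m\<^sub>a\<^sub>x" 50) where
  "x \<prec>\<^sub>m\<^sub>a\<^sub>x y \<longleftrightarrow> (\<exists>D. max_doubly_stochastic D \<and> x = max_mult_vec D y)"

end

theory Submission
  imports Defs
begin

text \<open>
  A nonnegative matrix is max-doubly stochastic exactly when its entries are at most \<open>1\<close> and every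
  row and every column contains the entry \<open>1\<close>. Such a matrix \<open>D\<close> cannot raise the maximum of \<open>y\<close>,
  since its entries are at most \<open>1\<close>; it keeps the maximum, since the column at which \<open>y\<close> is maximal
  contains a \<open>1\<close>; and it cannot lower the minimum, since every row contains a \<open>1\<close>.

  Conversely, the inequality \<open>d y\<^sub>k \<le> x\<^sub>i\<close> has a largest solution \<open>d \<in> [0, 1]\<close>, namely \<open>1\<close> if
  \<open>y\<^sub>k \<le> x\<^sub>i\<close> and \<open>x\<^sub>i / y\<^sub>k\<close> otherwise. Taking these solutions as the entries of \<open>D\<close> makes
  \<open>d y\<^sub>k = min x\<^sub>i y\<^sub>k\<close>, so that \<open>(D \<otimes> y)\<^sub>i = min x\<^sub>i (max y)\<close>, which is \<open>x\<^sub>i\<close> because the maxima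
  agree. A minimal entry of \<open>y\<close> lies below every \<open>x\<^sub>i\<close> and gives a \<open>1\<close> in each row; a maximal entry
  of \<open>x\<close> lies above every \<open>y\<^sub>k\<close> and gives a \<open>1\<close> in each column.
\<close>

lemma MAX_eq_iff:
  fixes f :: "'n::finite \<Rightarrow> 'a::linorder"
  shows "(MAX i. f i) = m \<longleftrightarrow> (\<forall>i. f i \<le> m) \<and> (\<exists>i. f i = m)"
  by (subst Max_eq_iff) auto

lemma ex_MAX:
  fixes f :: "'n::finite \<Rightarrow> 'a::linorder"
  obtains i where "f i = (MAX i. f i)"
  using MAX_eq_iff by metis

lemma ex_MIN:
  fixes f :: "'n::finite \<Rightarrow> 'a::linorder"
  obtains i where "f i = (MIN i. f i)"
  using Min_in[of "range f"] by fastforce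

text \<open>
  Both products with \<open>1\<close> reduce to row and column maxima, and a maximum equals \<open>1\<close> iff \<open>1\<close> is an
  upper bound that is attained; rows and columns give the same upper bound on the entries.
\<close>

lemma max_doubly_stochastic_iff:
  fixes D :: "real ^ 'n ^ 'n"
  shows "max_doubly_stochastic D \<longleftrightarrow>
    (\<forall>i k. 0 \<le> D $ i $ k \<and> D $ i $ k \<le> 1) \<and>
    (\<forall>i. \<exists>k. D $ i $ k = 1) \<and> (\<forall>k. \<exists>i. D $ i $ k = 1)"
  unfolding max_doubly_stochastic_def Rmax_mats_def Rmax_def max_mult_vec_def max_vec_mult_def
  by (auto simp: vec_eq_iff MAX_eq_iff)

lemma max_mult_vec_eq_iff:
  fixes A :: "real ^ 'n ^ 'm"
  shows "x = max_mult_vec A y \<longleftrightarrow>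
    (\<forall>i. (\<forall>k. A $ i $ k * y $ k \<le> x $ i) \<and> (\<exists>k. A $ i $ k * y $ k = x $ i))"
  unfolding max_mult_vec_def by (auto simp: vec_eq_iff MAX_eq_iff eq_commute[of "x $ _"])

text \<open>
  The entries of \<open>D\<close> being at most \<open>1\<close> bounds \<open>x\<close> above by the maximum of \<open>y\<close>. A \<open>1\<close> at position
  \<open>(i, k)\<close> forces \<open>y $ k \<le> x $ i\<close>: used in the column of a maximal \<open>y $ k\<close> it shows that the
  bound is attained, and used in every row it bounds \<open>x\<close> below by the minimum of \<open>y\<close>.
\<close>

lemma max_majorized_imp_MAX_eq_MIN_le:
  fixes x y :: "real ^ 'n"
  assumes y: "y \<in> Rmax_vecs" and maj: "x \<prec>\<^sub>m\<^sub>a\<^sub>x y"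
  shows "(MAX i. x $ i) = (MAX i. y $ i)" and "(MIN i. y $ i) \<le> (MIN i. x $ i)"
proof -
  obtain D where "max_doubly_stochastic D" and xD: "x = max_mult_vec D y"
    using maj unfolding max_majorized_def by blast
  then have le1: "\<And>i k. D $ i $ k \<le> 1"
    and row: "\<And>i. \<exists>k. D $ i $ k = 1" and col: "\<And>k. \<exists>i. D $ i $ k = 1"
    by (auto simp: max_doubly_stochastic_iff)
  have y0: "0 \<le> y $ k" for k
    using y by (simp add: Rmax_vecs_def Rmax_def)
  have ge: "D $ i $ k * y $ k \<le> x $ i" and att: "\<exists>k. D $ i $ k * y $ k = x $ i" for i k
    using xD max_mult_vec_eq_iff by blast+
  have upper: "x $ i \<le> (MAX i. y $ i)" for i
  proof -
    obtain k where "x $ i = D $ i $ k * y $ k"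
      using att by metis
    also have "\<dots> \<le> y $ k"
      using mult_right_mono[OF le1 y0] by simp
    also have "\<dots> \<le> (MAX i. y $ i)"
      by simp
    finally show ?thesis .
  qed
  obtain q where q: "y $ q = (MAX i. y $ i)"
    by (rule ex_MAX)
  obtain p where p: "D $ p $ q = 1"
    using col by blast
  have "x $ p = (MAX i. y $ i)"
    using ge[of p q] upper[of p] unfolding p q by linarith
  with upper show "(MAX i. x $ i) = (MAX i. y $ i)"
    by (auto simp only: MAX_eq_iff)
  have "(MIN i. y $ i) \<le> x $ i" for i
  proof -
    obtain k where "D $ i $ k = 1"
      using row by blast
    with ge[of i k] have "y $ k \<le> x $ i"
      by simp
    moreover have "(MIN i. y $ i) \<le> y $ k"
      by simp
    ultimately show ?thesis
      by linarith
  qed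
  then show "(MIN i. y $ i) \<le> (MIN i. x $ i)"
    by (metis ex_MIN)
qed

text \<open>
  The candidate \<open>D\<close> is the residual of \<open>x\<close> by \<open>y\<close> cut off at \<open>1\<close>. The equality of the maxima gives
  both \<open>D \<otimes> y = x\<close> and the \<open>1\<close> in each column, and the inequality of the minima gives the \<open>1\<close> in
  each row.
\<close>

lemma max_majorized_if_MAX_eq_MIN_le:
  fixes x y :: "real ^ 'n"
  assumes x: "x \<in> Rmax_vecs"
    and max_eq: "(MAX i. x $ i) = (MAX i. y $ i)"
    and min_le: "(MIN i. y $ i) \<le> (MIN i. x $ i)"
  shows "x \<prec>\<^sub>m\<^sub>a\<^sub>x y"
proof -
  \<comment> \<open>Entrywise the largest matrix over \<open>[0, 1]\<close> with \<open>D \<otimes> y \<le> x\<close>; a division only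
    happens when \<open>0 \<le> x $ i < y $ k\<close>.\<close>
  define D :: "real ^ 'n ^ 'n"
    where "D = (\<chi> i k. if y $ k \<le> x $ i then 1 else x $ i / y $ k)"
  have x0: "0 \<le> x $ i" for i
    using x by (simp add: Rmax_vecs_def Rmax_def)
  have D_mult: "D $ i $ k * y $ k = min (x $ i) (y $ k)" for i k
    using x0[of i] by (simp add: D_def)
  obtain p where p: "x $ p = (MAX i. x $ i)"
    by (rule ex_MAX)
  obtain q where q: "y $ q = (MAX i. y $ i)"
    by (rule ex_MAX)
  obtain r where r: "y $ r = (MIN i. y $ i)"
    by (rule ex_MIN)
  have y_le: "y $ k \<le> x $ p" for k
    using p max_eq by simp
  have x_le: "x $ i \<le> y $ q" for i
    by (metis Max_ge finite finite_imageI max_eq q rangeI)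
  have le_x: "y $ r \<le> x $ i" for i
    using r min_le by (metis Min_le finite finite_imageI order_trans rangeI)
  have "max_doubly_stochastic D"
    unfolding max_doubly_stochastic_iff
  proof (intro conjI allI)
    fix i k
    show "0 \<le> D $ i $ k" and "D $ i $ k \<le> 1"
      using x0[of i] by (auto simp: D_def divide_simps)
    show "\<exists>k. D $ i $ k = 1"
      using le_x[of i] by (intro exI[of _ r]) (simp add: D_def)
    show "\<exists>i. D $ i $ k = 1"
      using y_le[of k] by (intro exI[of _ p]) (simp add: D_def)
  qed
  moreover have "x = max_mult_vec D y"
    unfolding max_mult_vec_eq_iff D_mult using x_le by (metis min.absorb1 min.cobounded1)
  ultimately show ?thesis
    unfolding max_majorized_def by blast
qed

theorem theorem3p2:
  fixes x y :: "real ^ 'n"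
  assumes "x \<in> Rmax_vecs" and "y \<in> Rmax_vecs"
  shows "x \<prec>\<^sub>m\<^sub>a\<^sub>x y \<longleftrightarrow>
    (MAX i. x $ i) = (MAX i. y $ i) \<and> (MIN i. x $ i) \<ge> (MIN i. y $ i)"
  using assms max_majorized_imp_MAX_eq_MIN_le max_majorized_if_MAX_eq_MIN_le by blast

end
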